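(* Let $n\ge 2$, let $a,b>0$, and let $\alpha,\beta$ be nonnegative functions on $(0,\max\{a,b\}]$ such that $t\mapsto t\frac{\alpha(t)}{\beta(t)}$ is increasing on $(0,\max\{a,b\}]$ and all the integrals below are defined. Then $$\int_0^a t^{n-1}\alpha(t)\,dt-a\frac{\alpha(a)}{\beta(a)}\int_0^a t^{n-2}\beta(t)\,dt\le\int_0^b t^{n-1}\alpha(t)\,dt-a\frac{\alpha(a)}{\beta(a)}\int_0^b t^{n-2}\beta(t)\,dt.$$
   Context: "Increasing" is in the non-strict sense. The quotient $\alpha/\beta$ is assumed to be defined, i.e. $\beta(t)>0$ on $(0,\max\{a,b\}]$; "the integrals are defined" means they exist and are finite. Both cases $a\le b$ and $a>b$ are allowed. *)

theory Defs
  imports "HOL-Analysis.Analysis"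
begin

end

theory Submission
  imports Defs
begin

text \<open>
  With $c = a\,\alpha(a)/\beta(a)$, the function
  $t^{n-1}\alpha(t) - c\,t^{n-2}\beta(t) = t^{n-2}\beta(t)\,(t\,\alpha(t)/\beta(t) - c)$
  is nonpositive on $(0,a]$ and nonnegative on $[a,\max\{a,b\}]$. Hence among the integrals of this
  function over the intervals $(0,b]$ the one with $b = a$ is the smallest, and the comparison already
  holds pointwise for the integrands cut off by the two indicator functions.
\<close>

theorem lemma1:
  fixes n :: nat and a b :: real and \<alpha> \<beta> :: "real \<Rightarrow> real"
  assumes "n \<ge> 2"
    and "a > 0" and "b > 0"
    and "\<And>t. t \<in> {0<..max a b} \<Longrightarrow> \<alpha> t \<ge> 0"
    and "\<And>t. t \<in> {0<..max a b} \<Longrightarrow> \<beta> t > 0"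
    and "mono_on {0<..max a b} (\<lambda>t. t * (\<alpha> t / \<beta> t))"
    and "set_integrable lebesgue {0<..a} (\<lambda>t. t ^ (n - 1) * \<alpha> t)"
    and "set_integrable lebesgue {0<..a} (\<lambda>t. t ^ (n - 2) * \<beta> t)"
    and "set_integrable lebesgue {0<..b} (\<lambda>t. t ^ (n - 1) * \<alpha> t)"
    and "set_integrable lebesgue {0<..b} (\<lambda>t. t ^ (n - 2) * \<beta> t)"
  shows "(LINT t:{0<..a}|lebesgue. t ^ (n - 1) * \<alpha> t)
           - a * (\<alpha> a / \<beta> a) * (LINT t:{0<..a}|lebesgue. t ^ (n - 2) * \<beta> t)
       \<le> (LINT t:{0<..b}|lebesgue. t ^ (n - 1) * \<alpha> t)
           - a * (\<alpha> a / \<beta> a) * (LINT t:{0<..b}|lebesgue. t ^ (n - 2) * \<beta> t)"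
proof -
  define c where "c = a * (\<alpha> a / \<beta> a)"
  define f where "f t = t ^ (n - 1) * \<alpha> t - c * (t ^ (n - 2) * \<beta> t)" for t
  \<comment> \<open>Both halves are needed for \<open>x = a\<close> and \<open>x = b\<close>:
    integrability for the monotonicity of the integral, the value for translating the result back to
    the claim.\<close>
  have split: "set_integrable lebesgue {0<..x} f \<and>
      (LINT t:{0<..x}|lebesgue. f t)
        = (LINT t:{0<..x}|lebesgue. t ^ (n - 1) * \<alpha> t)
          - c * (LINT t:{0<..x}|lebesgue. t ^ (n - 2) * \<beta> t)"
    if "set_integrable lebesgue {0<..x} (\<lambda>t. t ^ (n - 1) * \<alpha> t)"
      and "set_integrable lebesgue {0<..x} (\<lambda>t. t ^ (n - 2) * \<beta> t)" for x
    using that unfolding f_def by (simp add: set_integral_diff)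
  have factor: "f t = t ^ (n - 2) * \<beta> t * (t * (\<alpha> t / \<beta> t) - c)"
    if "t \<in> {0<..max a b}" for t
  proof -
    \<comment> \<open>Subtraction on naturals truncates, so this rests on \<open>n \<ge> 2\<close>;
      for \<open>n = 1\<close> both exponents would be 0.\<close>
    have "t ^ (n - 1) = t ^ (n - 2) * t"
      using \<open>n \<ge> 2\<close> by (metis Suc_1 Suc_diff_Suc Suc_le_lessD diff_Suc_1 mult.commute power_Suc)
    then show ?thesis
      using assms(5)[OF that] by (simp add: f_def field_simps)
  qed
  have nonpos: "f t \<le> 0" if "0 < t" "t \<le> a" for t
  proof -
    \<comment> \<open>\<open>c\<close> is the value at \<open>a\<close> of the increasing function,
      so the sign of the last factor of \<open>f t\<close> depends only on which side of
      \<open>a\<close> the point lies.\<close>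
    have "t * (\<alpha> t / \<beta> t) \<le> c"
      unfolding c_def using that \<open>a > 0\<close> by (intro mono_onD[OF assms(6)]) auto
    then show ?thesis
      using that assms(5)[of t] by (simp add: factor mult_nonneg_nonpos le_max_iff_disj)
  qed
  have nonneg: "0 \<le> f t" if "a < t" "t \<le> b" for t
  proof -
    have "c \<le> t * (\<alpha> t / \<beta> t)"
      unfolding c_def using that \<open>a > 0\<close> by (intro mono_onD[OF assms(6)]) auto
    then show ?thesis
      using that \<open>a > 0\<close> assms(5)[of t] by (simp add: factor le_max_iff_disj)
  qed
  have "(LINT t:{0<..a}|lebesgue. f t) \<le> (LINT t:{0<..b}|lebesgue. f t)"
    unfolding set_lebesgue_integral_def
  proof (rule integral_mono)
    show "integrable lebesgue (\<lambda>t. indicator {0<..a} t *\<^sub>R f t)"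
      using split[OF assms(7,8)] by (simp add: set_integrable_def)
    show "integrable lebesgue (\<lambda>t. indicator {0<..b} t *\<^sub>R f t)"
      using split[OF assms(9,10)] by (simp add: set_integrable_def)
    \<comment> \<open>The sides differ only for \<open>t\<close> between \<open>a\<close> and
      \<open>b\<close>: if \<open>b < t \<le> a\<close>, the right side is 0 and
      \<open>nonpos\<close> applies; if \<open>a < t \<le> b\<close>, the left side is 0 and
      \<open>nonneg\<close> applies. So no case split on the order of \<open>a\<close> and
      \<open>b\<close> is needed.\<close>
    show "indicator {0<..a} t *\<^sub>R f t \<le> indicator {0<..b} t *\<^sub>R f t" for t
      using nonpos[of t] nonneg[of t] by (auto simp: indicator_def)
  qed
  then show ?thesis
    using split[OF assms(7,8)] split[OF assms(9,10)] by (simp add: c_def)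
qed

end
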